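(* Let $L\subset\mathbb{P}^2$ be a real line, $\mathbb{A}^2=\mathbb{P}^2\setminus L$, and let $S\subset\mathbb{A}^2$ be an affine plane curve defined over $\mathbb{R}$. Suppose that $S_{\mathbb{R}}$ is non-empty and has no other singularities than ordinary real multiple points. Further, let $Q=\mathcal{V}(q)\subset\mathbb{P}^2$ be a non-degenerate conic defined by a real quadratic polynomial $q$ which restricts to a positive definite quadratic form on $\mathbb{A}^2_{\mathbb{R}}$. Assume that the polar point $L^{\perp}$ of $L$ with respect to $Q$ is not contained in $S_{\mathbb{R}}$. Then the real affine reciprocal polar variety $W_L^{\perp}(S_{\mathbb{R}})$ contains at least one non-singular point from each connected component of $S_{\mathbb{R}}$.
   Context: Curves are complex algebraic varieties (zero sets of polynomials, possibly reducible), and $\mathcal{V}(\cdot)$ denotes the zero set. $S_{\mathbb{R}}$ denotes the set of real points of $S$, with the Euclidean topology (connected components are meant in this topology). $S_{\mathrm{ns}}$ denotes the set of non-singular points of $S$; a singularity of $S_{\mathbb{R}}$ is a point of $S_{\mathbb{R}}$ not in $S_{\mathrm{ns}}$, and a non-singular point of $S_{\mathbb{R}}$ is a point of $S_{\mathbb{R}}\cap S_{\mathrm{ns}}$. An ordinary real multiple point is a singular point with at least two real branches, such that the tangent lines intersect pairwise transversally. Choose homogeneous coordinates $X_0,X_1,X_2$ with $L=\mathcal{V}(X_0)$. "$q$ restricts to a positive definite quadratic form on $\mathbb{A}^2_{\mathbb{R}}$" means that $q(0,X_1,X_2)$ is a positive definite quadratic form in $X_1,X_2$. Polarity with respect to $Q=\mathcal{V}(q)$: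 for a point $A$, its polar line is $A^{\perp}=\mathcal{V}\big(\sum_i\frac{\partial q}{\partial X_i}(A)X_i\big)$; for a linear space $M$, $M^{\perp}$ is the intersection of the $A^{\perp}$ for $A\in M$. Thus $L^{\perp}$ is the point $A$ with $A^{\perp}=L$. For $P\in S$ with $P\ne L^{\perp}$, let $\langle P,L^{\perp}\rangle$ be the line spanned by $P$ and $L^{\perp}$; its polar $\langle P,L^{\perp}\rangle^{\perp}=P^{\perp}\cap L$ is a point on the line at infinity $L$, and $I_{P,L^{\perp}}\subset\mathbb{A}^2$ denotes the line through the origin with that point at infinity. For $P\in S_{\mathrm{ns}}$, $t_PS$ denotes the affine tangent line to $S$ at $P$ translated to the origin, regarded as a linear subspace of $\mathbb{A}^2$ (viewed as a vector space). The affine reciprocal polar variety $W_L^{\perp}(S)$ is the Zariski closure in $\mathbb{A}^2$ of $\{P\in S_{\mathrm{ns}}\setminus\{L^{\perp}\}\mid t_PS=I_{P,L^{\perp}}\}$, and $W_L^{\perp}(S_{\mathbb{R}})$ is its set of real points. *)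

theory Defs
  imports "HOL-Analysis.Analysis" "HOL-Computational_Algebra.Polynomial"
begin

section \<open>Affine plane curves and their real points\<close>

text \<open>
  A polynomial in two variables has type \<^typ>\<open>'a poly poly\<close>: the inner variable is the first
  coordinate, the outer variable the second one.
\<close>

definition eval2 :: "'a::comm_ring_1 poly poly \<Rightarrow> 'a^2 \<Rightarrow> 'a" where
  "eval2 p v = poly (poly p [:v$2:]) (v$1)"

definition dx :: "'a::field poly poly \<Rightarrow> 'a poly poly" where
  "dx p = map_poly pderiv p"

definition dy :: "'a::field poly poly \<Rightarrow> 'a poly poly" where
  "dy p = pderiv p"

definition zero_locus :: "complex poly poly \<Rightarrow> (complex^2) set" where
  "zero_locus p = {v. eval2 p v = 0}"

definition complexify_poly :: "real poly poly \<Rightarrow> complex poly poly" where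
  "complexify_poly = map_poly (map_poly complex_of_real)"

definition real_affine_curve :: "(complex^2) set \<Rightarrow> bool" where
  "real_affine_curve S \<longleftrightarrow>
     (\<exists>f. (\<nexists>c. f = [:[:c:]:]) \<and> S = zero_locus (complexify_poly f))"

definition complexify :: "real^'n \<Rightarrow> complex^'n" where
  "complexify x = (\<chi> i. complex_of_real (x$i))"

text \<open>The real points form a subset of \<^typ>\<open>real^2\<close> and so carry the Euclidean topology.\<close>

definition real_points :: "(complex^2) set \<Rightarrow> (real^2) set" where
  "real_points S = {x. complexify x \<in> S}"

definition vanishing_ideal :: "(complex^2) set \<Rightarrow> complex poly poly set" where
  "vanishing_ideal S = {p. \<forall>v\<in>S. eval2 p v = 0}"

definition zariski_closure :: "(complex^2) set \<Rightarrow> (complex^2) set" where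
  "zariski_closure S = {v. \<forall>p\<in>vanishing_ideal S. eval2 p v = 0}"

text \<open>
  The Zariski tangent space of the variety \<open>S\<close> (with its reduced structure) at \<open>P\<close>, as a linear
  subspace. At a non-singular point of a curve it is the tangent line translated to the origin.
\<close>

definition tangent_space :: "(complex^2) set \<Rightarrow> complex^2 \<Rightarrow> (complex^2) set" where
  "tangent_space S P =
     {v. \<forall>p\<in>vanishing_ideal S. eval2 (dx p) P * v$1 + eval2 (dy p) P * v$2 = 0}"

text \<open>Curves are pure of dimension 1, so non-singular means that the tangent space is a line.\<close>

definition nonsingular_points :: "(complex^2) set \<Rightarrow> (complex^2) set" where
  "nonsingular_points S = {P \<in> S. vec.dim (tangent_space S P) = 1}"

section \<open>Ordinary real multiple points\<close>

text \<open>
  Real analyticity at \<open>0\<close> is expressed by an extension of each coordinate to a holomorphic function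
  near \<open>0\<close>.
\<close>

definition analytic_at_0 :: "(real \<Rightarrow> real^'n) \<Rightarrow> bool" where
  "analytic_at_0 \<gamma> \<longleftrightarrow>
     (\<forall>i. \<exists>g. g analytic_on {0} \<and>
        (\<forall>\<^sub>F t in nhds 0. g (complex_of_real t) = complex_of_real (\<gamma> t $ i)))"

text \<open>Only the germ of \<open>\<gamma>\<close> at \<open>0\<close> matters in the following two definitions.\<close>

definition smooth_real_branch :: "(complex^2) set \<Rightarrow> real^2 \<Rightarrow> (real \<Rightarrow> real^2) \<Rightarrow> bool" where
  "smooth_real_branch S P \<gamma> \<longleftrightarrow>
     analytic_at_0 \<gamma> \<and> \<gamma> 0 = P \<and> vector_derivative \<gamma> (at 0) \<noteq> 0 \<and>
     (\<forall>\<^sub>F t in nhds 0. \<gamma> t \<in> real_points S)"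

text \<open>
  The real branches of \<open>S\<close> at \<open>P\<close>, which make up the germ of the real points of \<open>S\<close> at \<open>P\<close>, are at
  least two in number, smooth, and have pairwise distinct tangent lines. No condition is
  imposed on pairs of complex conjugate branches.
\<close>

definition ordinary_real_multiple_point :: "(complex^2) set \<Rightarrow> real^2 \<Rightarrow> bool" where
  "ordinary_real_multiple_point S P \<longleftrightarrow>
     P \<in> real_points S \<and> complexify P \<notin> nonsingular_points S \<and>
     (\<exists>\<Gamma>. finite \<Gamma> \<and> card \<Gamma> \<ge> 2 \<and>
        (\<forall>\<gamma>\<in>\<Gamma>. smooth_real_branch S P \<gamma>) \<and>
        (\<forall>d>0. \<forall>\<^sub>F X in nhds P. X \<in> real_points S \<longrightarrow> (\<exists>\<gamma>\<in>\<Gamma>. \<exists>t. \<bar>t\<bar> < d \<and> \<gamma> t = X)) \<and>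
        (\<forall>\<gamma>\<in>\<Gamma>. \<forall>\<delta>\<in>\<Gamma>. \<gamma> \<noteq> \<delta> \<longrightarrow>
           span {vector_derivative \<gamma> (at 0)} \<noteq> span {vector_derivative \<delta> (at 0)}))"

section \<open>Polarity and the reciprocal polar variety\<close>

text \<open>
  Linear subspaces of the projective plane are represented by the corresponding linear subspaces
  of \<^typ>\<open>complex^3\<close>. The homogeneous coordinates \<open>X\<^sub>0\<close>, \<open>X\<^sub>1\<close>, \<open>X\<^sub>2\<close> are the components \<open>1\<close>,
  \<open>2\<close>, \<open>3\<close>, chosen so that \<open>L\<close> is given by \<open>X\<^sub>0 = 0\<close>; an affine point \<open>(x, y)\<close> is \<open>(1 : x : y)\<close>.
\<close>

definition proj_point :: "complex^2 \<Rightarrow> (complex^3) set" where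
  "proj_point P = vec.span {vector [1, P$1, P$2]}"

definition line_at_infinity :: "(complex^3) set" where
  "line_at_infinity = {X. X$1 = 0}"

definition quadratic_form :: "'a::comm_ring_1^3^3 \<Rightarrow> 'a^3 \<Rightarrow> 'a" where
  "quadratic_form B X = (\<Sum>i\<in>UNIV. \<Sum>j\<in>UNIV. B$i$j * X$i * X$j)"

definition complexify_matrix :: "real^3^3 \<Rightarrow> complex^3^3" where
  "complexify_matrix B = (\<chi> i. complexify (B$i))"

definition partial :: "(complex^3 \<Rightarrow> complex) \<Rightarrow> 3 \<Rightarrow> complex^3 \<Rightarrow> complex" where
  "partial q i A = deriv (\<lambda>t. q (\<chi> j. if j = i then t else A$j)) (A$i)"

definition polar :: "(complex^3 \<Rightarrow> complex) \<Rightarrow> (complex^3) set \<Rightarrow> (complex^3) set" where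
  "polar q M = {X. \<forall>A\<in>M. (\<Sum>i\<in>UNIV. partial q i A * X$i) = 0}"

definition join :: "(complex^3) set \<Rightarrow> (complex^3) set \<Rightarrow> (complex^3) set" where
  "join M N = vec.span (M \<union> N)"

text \<open>
  For a point \<open>(0 : v\<^sub>1 : v\<^sub>2)\<close> of the line at infinity, the affine line through the origin with that
  point at infinity consists of the multiples of \<open>(v\<^sub>1, v\<^sub>2)\<close>.
\<close>

definition line_through_origin :: "(complex^3) set \<Rightarrow> (complex^2) set" where
  "line_through_origin M = {v. vector [0, v$1, v$2] \<in> M}"

definition polar_direction :: "(complex^3 \<Rightarrow> complex) \<Rightarrow> complex^2 \<Rightarrow> (complex^2) set" where
  "polar_direction q P =
     line_through_origin (polar q (join (proj_point P) (polar q line_at_infinity)))"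

definition reciprocal_polar_variety ::
    "(complex^3 \<Rightarrow> complex) \<Rightarrow> (complex^2) set \<Rightarrow> (complex^2) set" where
  "reciprocal_polar_variety q S =
     zariski_closure {P \<in> nonsingular_points S.
       proj_point P \<noteq> polar q line_at_infinity \<and> tangent_space S P = polar_direction q P}"

end

theory Submission
  imports Defs "HOL-Complex_Analysis.Conformal_Mappings"
begin

text \<open>
  The affine quadric \<open>h(x) = q(1, x)\<close> is coercive, so it has a minimum \<open>P\<close> on the closed component
  \<open>C\<close>. Half of its gradient \<open>w\<close> at \<open>P\<close> cuts out the direction \<open>P\<^sup>\<bottom> \<inter> L\<close>, it vanishes only at the polar
  point of \<open>L\<close>, and every smooth real arc of the curve through \<open>P\<close> has velocity orthogonal to \<open>w\<close>,
  since it stays in \<open>C\<close>. An ordinary multiple point has two arcs with distinct tangents, so \<open>P\<close> is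
  non-singular. At a non-singular point some polynomial \<open>g\<close> of the vanishing ideal has non-zero
  differential. Continuity of the roots of the defining polynomial produces complex points of the
  curve over all nearby real abscissae; they are zeros of \<open>g\<close>, so the implicit function argument for
  \<open>g\<close> makes them unique, hence real, and they form a smooth real arc whose tangent is the
  kernel of the differential of \<open>g\<close>.
\<close>

section \<open>Derivatives and roots of bivariate polynomials\<close>

lemma eval2_pCons: "eval2 (pCons a p) v = poly a (v$1) + v$2 * eval2 p v"
  by (simp add: eval2_def)

lemma eval2_0 [simp]: "eval2 0 v = 0"
  by (simp add: eval2_def)

lemma eval2_dx_pCons: "eval2 (dx (pCons a p)) v = poly (pderiv a) (v$1) + v$2 * eval2 (dx p) v"
  by (cases "a = 0 \<and> p = 0") (auto simp: dx_def map_poly_pCons eval2_pCons)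

lemma eval2_dy_pCons: "eval2 (dy (pCons a p)) v = eval2 p v + v$2 * eval2 (dy p) v"
  by (simp add: dy_def pderiv_pCons eval2_def)

lemma continuous_on_eval2 [continuous_intros]:
  fixes X :: "'b::topological_space \<Rightarrow> complex^2"
  assumes "continuous_on A X"
  shows "continuous_on A (\<lambda>t. eval2 p (X t))"
proof (induction p)
  case (pCons a p)
  then show ?case
    unfolding eval2_pCons by (intro continuous_intros assms)
qed simp

lemma has_field_derivative_eval2:
  fixes X Y :: "complex \<Rightarrow> complex"
  assumes "(X has_field_derivative X') (at t)" "(Y has_field_derivative Y') (at t)"
  shows "((\<lambda>t. eval2 p (vector [X t, Y t])) has_field_derivative
      eval2 (dx p) (vector [X t, Y t]) * X' + eval2 (dy p) (vector [X t, Y t]) * Y') (at t)"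
proof (induction p)
  case 0
  then show ?case by (simp add: dx_def dy_def)
next
  case (pCons a p)
  have "((\<lambda>t. poly a (X t)) has_field_derivative poly (pderiv a) (X t) * X') (at t)"
    by (rule DERIV_chain2[OF poly_DERIV assms(1)])
  note D = DERIV_add[OF this DERIV_mult[OF assms(2) pCons.IH]]
  show ?case
    unfolding eval2_pCons eval2_dx_pCons eval2_dy_pCons
    by (rule DERIV_cong, use D in simp) (simp add: algebra_simps)
qed

text \<open>Real coefficients commute with conjugation, so the zeros of a real polynomial come in
  conjugate pairs; this is what later forces unique roots over real abscissae to be real.\<close>

lemma eval2_complexify_poly_cnj:
  "eval2 (complexify_poly f) (vector [cnj x, cnj y]) =
     cnj (eval2 (complexify_poly f) (vector [x, y]))"
proof -
  have *: "poly (map_poly complex_of_real a) (cnj z) = cnj (poly (map_poly complex_of_real a) z)"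
    for a z
    by (induction a) (auto simp: map_poly_pCons)
  show ?thesis
    unfolding complexify_poly_def
    by (induction f) (auto simp: map_poly_pCons eval2_pCons *)
qed

section \<open>Persistence of roots and implicit functions\<close>

text \<open>A minimum modulus argument: if \<open>F x\<close> had no zero in the disc, its
  reciprocal would be holomorphic there, yet for \<open>x\<close> near \<open>a\<close> it would be
  larger at the centre \<open>b\<close> than the bound valid on the boundary circle.\<close>

lemma continuity_of_roots:
  fixes F :: "complex \<Rightarrow> complex \<Rightarrow> complex"
  assumes cont: "continuous_on UNIV (\<lambda>(x, y). F x y)"
    and holo: "\<And>x. F x holomorphic_on UNIV"
    and root: "F a b = 0" and "s > 0"
    and isolated: "\<And>y. y \<in> cball b s \<Longrightarrow> y \<noteq> b \<Longrightarrow> F a y \<noteq> 0"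
  shows "\<exists>d>0. \<forall>x\<in>ball a d. \<exists>y\<in>ball b s. F x y = 0"
proof -
  have contF: "continuous_on A (F x)" for A x
    using holo holomorphic_on_imp_continuous_on holomorphic_on_subset by blast
  have "sphere b s \<noteq> {}"
    using \<open>s > 0\<close> by simp
  then obtain y0 where y0: "y0 \<in> sphere b s" "\<And>y. y \<in> sphere b s \<Longrightarrow> norm (F a y0) \<le> norm (F a y)"
    using continuous_attains_inf[OF compact_sphere _ continuous_on_norm[OF contF]] by blast
  \<comment> \<open>The minimum of the modulus of \<open>F a\<close> on the circle; it is positive
    because \<open>b\<close> is the only root of \<open>F a\<close> in the closed disc.\<close>
  define \<mu> where "\<mu> = norm (F a y0)"
  have "\<mu> > 0"
    using y0(1) isolated[of y0] \<open>s > 0\<close> by (auto simp: \<mu>_def)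
  \<comment> \<open>Compactness makes the perturbation from \<open>F a y\<close> to
    \<open>F x y\<close> smaller than \<open>\<mu>/2\<close> for all \<open>y\<close> in the disc at
    once.\<close>
  have "uniformly_continuous_on (cball a 1 \<times> cball b s) (\<lambda>(x, y). F x y)"
    by (intro compact_uniformly_continuous compact_Times compact_cball)
       (rule continuous_on_subset[OF cont], simp)
  from uniformly_continuous_onE[OF this, of "\<mu>/2"] \<open>\<mu> > 0\<close>
  obtain d where "d > 0" and d: "\<And>z z'. z \<in> cball a 1 \<times> cball b s \<Longrightarrow> z' \<in> cball a 1 \<times> cball b s \<Longrightarrow>
      dist z' z < d \<Longrightarrow> dist (case z' of (x, y) \<Rightarrow> F x y) (case z of (x, y) \<Rightarrow> F x y) < \<mu>/2"
    by auto
  have near: "norm (F x y - F a y) < \<mu>/2" if "x \<in> ball a (min d 1)" "y \<in> cball b s" for x y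
    using d[of "(a, y)" "(x, y)"] that by (auto simp: dist_Pair_Pair dist_norm norm_minus_commute)
  have "\<exists>y\<in>ball b s. F x y = 0" if x: "x \<in> ball a (min d 1)" for x
  proof (rule ccontr)
    assume nz: "\<not> ?thesis"
    have big: "norm (F x y) \<ge> \<mu>/2" if "y \<in> sphere b s" for y
    proof -
      have "norm (F a y) \<le> norm (F x y) + norm (F x y - F a y)"
        by norm
      moreover have "norm (F x y - F a y) < \<mu>/2"
        using that by (intro near x) auto
      moreover have "norm (F a y) \<ge> \<mu>"
        unfolding \<mu>_def using y0(2)[OF that] .
      ultimately show ?thesis by linarith
    qed
    have nz': "F x y \<noteq> 0" if "y \<in> cball b s" for y
      using nz big[of y] \<open>\<mu> > 0\<close> that by (cases "y \<in> ball b s") auto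
    \<comment> \<open>The maximum modulus principle carries the boundary bound
      \<open>2/\<mu>\<close> to the centre, where \<open>F x b\<close> is too small for it.\<close>
    have "norm (inverse (F x b)) \<le> 2/\<mu>"
    proof (rule maximum_modulus_frontier[of "\<lambda>y. inverse (F x y)" "cball b s"])
      show "(\<lambda>y. inverse (F x y)) holomorphic_on interior (cball b s)"
        using nz' by (intro holomorphic_intros holomorphic_on_subset[OF holo]) auto
      show "continuous_on (closure (cball b s)) (\<lambda>y. inverse (F x y))"
        using nz' by (intro continuous_intros contF) auto
      show "norm (inverse (F x z)) \<le> 2/\<mu>" if "z \<in> frontier (cball b s)" for z
        using le_imp_inverse_le[OF big[of z]] \<open>\<mu> > 0\<close> \<open>s > 0\<close> that by (simp add: norm_inverse)
    qed (use \<open>s > 0\<close> in auto)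
    moreover have "norm (F x b) < \<mu>/2"
      using near[OF x, of b] root \<open>s > 0\<close> by simp
    moreover have "F x b \<noteq> 0"
      using nz' \<open>s > 0\<close> by simp
    ultimately show False
      using \<open>\<mu> > 0\<close> unfolding norm_inverse by (simp add: field_simps)
  qed
  then show ?thesis
    using \<open>d > 0\<close> by (intro exI[of _ "min d 1"]) simp
qed

text \<open>Two functions share the work. \<open>F\<close> defines the curve and respects
  conjugation, but its own derivative may vanish, for instance when the equation has multiple
  factors. \<open>G\<close> vanishes wherever \<open>F\<close> does and has a non-zero derivative in
  the second variable, but need not respect conjugation. Existence of roots comes from
  \<open>F\<close>, uniqueness from \<open>G\<close>. The assumption \<open>lineG\<close> supplies
  the differential of \<open>G\<close> at the base point in all directions with first component
  1.\<close>

lemma implicit_real_branch: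
  fixes F G Gy :: "complex \<Rightarrow> complex \<Rightarrow> complex" and a b :: real
  assumes contF: "continuous_on UNIV (\<lambda>(x, y). F x y)"
    and holoF: "\<And>x. F x holomorphic_on UNIV"
    and conj: "\<And>x y. F (cnj x) (cnj y) = cnj (F x y)"
    and root: "F a b = 0"
    and FG: "\<And>x y. F x y = 0 \<Longrightarrow> G x y = 0"
    and dG: "\<And>x y. (G x has_field_derivative Gy x y) (at y)"
    and contGy: "continuous_on UNIV (\<lambda>(x, y). Gy x y)"
    and lineG: "\<And>m. ((\<lambda>x. G x (b + m * (x - a))) has_field_derivative gx + Gy a b * m) (at a)"
    and nz: "Gy a b \<noteq> 0"
  obtains \<phi> :: "real \<Rightarrow> real" and m \<delta> :: real where "\<delta> > 0" "\<phi> a = b"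
    "continuous_on (ball a \<delta>) \<phi>" "\<And>x. x \<in> ball a \<delta> \<Longrightarrow> F x (\<phi> x) = 0"
    "(\<phi> has_real_derivative m) (at a)" "gx + Gy a b * m = 0"
proof -
  define c where "c = Gy a b"
  have "c \<noteq> 0"
    using nz by (simp add: c_def)
  have "isCont (\<lambda>(x, y). Gy x y) (complex_of_real a, complex_of_real b)"
    using contGy by (simp add: continuous_on_eq_continuous_at)
  moreover have "norm c / 2 > 0"
    using \<open>c \<noteq> 0\<close> by simp
  ultimately obtain d where "d > 0" and d: "\<And>z. dist z (complex_of_real a, complex_of_real b) < d \<Longrightarrow>
      dist (case z of (x, y) \<Rightarrow> Gy x y) c < norm c / 2"
    unfolding continuous_at_eps_delta c_def by (metis (no_types, lifting) case_prod_conv)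
  \<comment> \<open>Half of \<open>d\<close>, because the distance in the product is bounded by the
    sum of the two coordinate distances.\<close>
  define r where "r = d / 2"
  have "r > 0"
    using \<open>d > 0\<close> by (simp add: r_def)
  have Gy_near: "norm (Gy x y - c) \<le> norm c / 2" if "x \<in> ball (of_real a) r"
      "y \<in> ball (of_real b) r" for x y
  proof -
    have "dist (x, y) (complex_of_real a, complex_of_real b) \<le> dist x a + dist y b"
      unfolding dist_Pair_Pair by (rule sqrt_sum_squares_le_sum) auto
    also have "\<dots> < d"
      using that by (simp add: r_def dist_commute)
    finally show ?thesis
      using d[of "(x, y)"] by (simp add: dist_norm)
  qed
  \<comment> \<open>The function \<open>G x y - c * y\<close> has \<open>y\<close>-derivative of
    norm at most half of that of \<open>c\<close>, so the mean value inequality applies to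
    it.\<close>
  have G_expand: "norm (G x y - G x y' - c * (y - y')) \<le> norm c / 2 * norm (y - y')"
    if "x \<in> ball (of_real a) r" "y \<in> ball (of_real b) r" "y' \<in> ball (of_real b) r" for x y y'
  proof -
    have "norm ((G x y - c * y) - (G x y' - c * y')) \<le> norm c / 2 * norm (y - y')"
    proof (rule field_differentiable_bound[where S = "ball (of_real b) r"])
      show "((\<lambda>y. G x y - c * y) has_field_derivative Gy x z - c)
          (at z within ball (of_real b) r)" for z
        by (rule DERIV_subset[OF _ subset_UNIV]) (auto intro!: derivative_eq_intros dG)
    qed (use that Gy_near in auto)
    then show ?thesis
      by (simp add: algebra_simps)
  qed
  have G_inj: "y = y'"
    if "x \<in> ball (of_real a) r" "y \<in> ball (of_real b) r" "y' \<in> ball (of_real b) r" "G x y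
        = G x y'" for x y y'
  proof -
    have "norm c * norm (y - y') \<le> norm c / 2 * norm (y - y')"
      using G_expand[OF that(1-3)] that(4) by (simp add: norm_mult)
    then have "norm c * norm (y - y') \<le> 0"
      by simp
    then show ?thesis
      using \<open>c \<noteq> 0\<close> by (simp add: mult_le_0_iff)
  qed
  \<comment> \<open>By injectivity of \<open>G x\<close> the roots of \<open>F x\<close> near \<open>b\<close> are isolated.\<close>
  have near_root: "\<exists>\<delta>>0. \<forall>x\<in>ball x0 \<delta>. \<exists>y\<in>ball y0 s. F x y = 0"
    if x0: "x0 \<in> ball (of_real a) r" and y0: "y0 \<in> ball (of_real b) r" and "F x0 y0 = 0"
      and s: "s > 0" "cball y0 s \<subseteq> ball (of_real b) r" for x0 y0 s
  proof (rule continuity_of_roots[OF contF holoF])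
    show "F x0 y \<noteq> 0" if "y \<in> cball y0 s" "y \<noteq> y0" for y
      using G_inj[OF x0 _ y0, of y] that s \<open>F x0 y0 = 0\<close> FG by (metis subsetD)
  qed fact+
  \<comment> \<open>The radius \<open>r/2\<close> keeps the closed disc around \<open>b\<close>
    inside the open disc on which \<open>G x\<close> is injective.\<close>
  from near_root[of a b "r/2"] root \<open>r > 0\<close>
  obtain \<delta>0 where "\<delta>0 > 0" and \<delta>0: "\<And>x. x \<in> ball (complex_of_real a) \<delta>0 \<Longrightarrow>
      \<exists>y\<in>ball (of_real b) (r/2). F x y = 0"
    by (force simp: subset_iff)
  define \<delta> where "\<delta> = min \<delta>0 r"
  have "\<delta> > 0"
    using \<open>\<delta>0 > 0\<close> \<open>r > 0\<close> by (simp add: \<delta>_def)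
  have "\<exists>y::real. y \<in> ball b r \<and> F x y = 0" if x: "x \<in> ball a \<delta>" for x :: real
  proof -
    have x': "complex_of_real x \<in> ball (of_real a) \<delta>0" "complex_of_real x \<in> ball (of_real a) r"
      using x by (auto simp: \<delta>_def)
    have "ball (complex_of_real b) (r/2) \<subseteq> ball (of_real b) r"
      using \<open>r > 0\<close> by (intro subset_ball) simp
    with \<delta>0[OF x'(1)] obtain y where y: "y \<in> ball (complex_of_real b) r" "F x y = 0"
      by blast
    \<comment> \<open>The conjugate root is also close to \<open>b\<close>, so uniqueness makes \<open>y\<close> real.\<close>
    have "F x (cnj y) = 0"
      using conj[of x y] y(2) by simp
    moreover have "cnj y \<in> ball (of_real b) r"
      using y(1) by (metis complex_cnj_complex_of_real complex_cnj_diff complex_mod_cnj dist_norm mem_ball)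
    ultimately have "cnj y = y"
      using G_inj[OF x'(2), of "cnj y" y] y FG by metis
    then obtain y' where "y = complex_of_real y'"
      by (metis Reals_cases Reals_cnj_iff)
    then show ?thesis
      using y by auto
  qed
  then obtain \<phi> where \<phi>: "\<And>x. x \<in> ball a \<delta> \<Longrightarrow> \<phi> x \<in> ball b r" "\<And>x. x \<in> ball a \<delta> \<Longrightarrow> F x (\<phi> x) = 0"
    by metis
  have unique: "y = \<phi> x" if "x \<in> ball a \<delta>" "y \<in> ball (of_real b) r" "F x y = 0" for x y
    using G_inj[of x y "\<phi> x"] that \<phi>[of x] FG by (simp add: \<delta>_def)
  have "\<phi> a = b"
    using unique[of a b] root \<open>\<delta> > 0\<close> \<open>r > 0\<close> by simp
  have cont: "isCont \<phi> x0" if x0: "x0 \<in> ball a \<delta>" for x0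
    unfolding continuous_at_eps_delta
  proof safe
    fix e :: real
    assume "e > 0"
    \<comment> \<open>The closed disc of radius \<open>s\<close> around \<open>\<phi> x0\<close>
      stays in the region of uniqueness, so any root found in it must be the value of
      \<open>\<phi>\<close>.\<close>
    define s where "s = min e ((r - dist b (\<phi> x0)) / 2)"
    have s: "s > 0" "s \<le> e" "dist b (\<phi> x0) + s < r"
      using \<phi>(1)[OF x0] \<open>e > 0\<close> by (auto simp: s_def min_def field_simps)
    have sub: "cball (complex_of_real (\<phi> x0)) s \<subseteq> ball (of_real b) r"
      using s(3) by (auto simp: subset_iff) (smt (verit) dist_of_real dist_triangle)
    from near_root[of x0 "\<phi> x0" s] \<phi>[OF x0] x0 s(1) sub
    obtain d where "d > 0" and d: "\<And>x. x \<in> ball (complex_of_real x0) d \<Longrightarrow>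
        \<exists>y\<in>ball (of_real (\<phi> x0)) s. F x y = 0"
      by (auto simp: \<delta>_def)
    have "dist (\<phi> x) (\<phi> x0) < e" if "dist x x0 < min d (\<delta> - dist a x0)" for x
    proof -
      have x: "x \<in> ball a \<delta>"
        using that dist_triangle[of a x x0] by (simp add: dist_commute)
      from d[of x] that obtain y where y: "y \<in> ball (complex_of_real (\<phi> x0)) s" "F x y = 0"
        by (auto simp: dist_commute)
      with sub unique[OF x, of y] have "y = \<phi> x"
        by (meson ball_subset_cball subsetD)
      then show ?thesis
        using y(1) s(2) by (simp add: dist_commute)
    qed
    then show "\<exists>d>0. \<forall>x. dist x x0 < d \<longrightarrow> dist (\<phi> x) (\<phi> x0) < e"
      using \<open>d > 0\<close> x0 by (intro exI[of _ "min d (\<delta> - dist a x0)"]) auto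
  qed
  define m where "m = - gx / c"
  \<comment> \<open>\<open>G\<close> has derivative \<open>0\<close> along the candidate tangent \<open>l\<close>, and \<open>G_expand\<close> turns this into a bound
    on the distance from \<open>\<phi>\<close> to \<open>l\<close>.\<close>
  define l where "l x = of_real b + m * (x - of_real a)" for x
  have "((\<lambda>x. G x (l x)) has_field_derivative 0) (at (complex_of_real a))"
    using lineG[of m] \<open>c \<noteq> 0\<close> by (simp add: m_def c_def[symmetric] l_def)
  moreover have "G a (l a) = 0"
    using FG[OF root] by (simp add: l_def)
  ultimately have "((\<lambda>x. G x (l x) / (x - a)) \<longlongrightarrow> 0) (at (complex_of_real a))"
    by (simp add: has_field_derivative_iff)
  moreover have "filterlim complex_of_real (at (complex_of_real a)) (at a)"
    by (auto simp: filterlim_at eventually_at_filter intro!: tendsto_intros)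
  ultimately have lim: "((\<lambda>x::real. G x (l x) / (of_real x - of_real a)) \<longlongrightarrow> 0) (at a)"
    by (rule filterlim_compose)
  have "((\<lambda>x. (of_real (\<phi> x) - l x) / (of_real x - of_real a)) \<longlongrightarrow> 0) (at a)"
  proof (rule Lim_null_comparison)
    show "((\<lambda>x::real. 2 / norm c * norm (G x (l x) / (of_real x - of_real a))) \<longlongrightarrow> 0) (at a)"
      using tendsto_mult[OF tendsto_const tendsto_norm[OF lim], of "2 / norm c"] by simp
    have "((\<lambda>x. l (complex_of_real x)) \<longlongrightarrow> l (of_real a)) (at a)"
      unfolding l_def by (intro tendsto_intros)
    then have "\<forall>\<^sub>F x in at a. l (complex_of_real x) \<in> ball (of_real b) r"
      using \<open>r > 0\<close> by (intro topological_tendstoD) (auto simp: l_def)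
    moreover have "\<forall>\<^sub>F x in at a. x \<in> ball a \<delta>"
      using \<open>\<delta> > 0\<close> by (intro eventually_at_in_open') auto
    ultimately show "\<forall>\<^sub>F x in at a. norm ((of_real (\<phi> x) - l x) / (of_real x - of_real a))
        \<le> 2 / norm c * norm (G x (l x) / (of_real x - of_real a))"
    proof eventually_elim
      case (elim x)
      define u where "u = of_real (\<phi> x) - l x"
      have "norm (G x (\<phi> x) - G x (l x) - c * u) \<le> norm c / 2 * norm u"
        unfolding u_def using elim \<phi>[OF elim(2)] by (intro G_expand) (auto simp: \<delta>_def)
      moreover have "G x (\<phi> x) = 0"
        using FG \<phi>(2)[OF elim(2)] by blast
      moreover have "norm (c * u) \<le> norm (0 - G x (l x) - c * u) + norm (G x (l x))"
        by norm
      ultimately have "norm c * norm u \<le> 2 * norm (G x (l x))"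
        by (simp add: norm_mult)
      then have "norm u \<le> 2 / norm c * norm (G x (l x))"
        using \<open>c \<noteq> 0\<close> by (simp add: field_simps)
      then have "norm u / norm (complex_of_real x - of_real a) \<le>
          2 / norm c * norm (G x (l x)) / norm (complex_of_real x - of_real a)"
        by (rule divide_right_mono) simp
      then show ?case
        by (simp add: norm_divide u_def)
    qed
  qed
  from tendsto_add[OF this tendsto_const[of m]]
  have "((\<lambda>x. (of_real (\<phi> x) - l x) / (of_real x - of_real a) + m) \<longlongrightarrow> m) (at a)"
    by simp
  then have slope: "((\<lambda>x. of_real ((\<phi> x - \<phi> a) / (x - a))) \<longlongrightarrow> m) (at a)"
    by (rule Lim_transform_eventually)
      (auto simp: eventually_at_filter l_def \<open>\<phi> a = b\<close> field_simps)
  \<comment> \<open>So far \<open>m\<close> is only a complex number; as a limit of real difference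
    quotients it must be real.\<close>
  have "Im m = 0"
    using tendsto_Im[OF slope] by (simp add: tendsto_const_iff)
  then have m: "m = of_real (Re m)"
    by (simp add: complex_eq_iff)
  have "(\<phi> has_real_derivative Re m) (at a)"
    using tendsto_Re[OF slope] by (simp add: has_field_derivative_iff)
  moreover have "gx + Gy a b * of_real (Re m) = 0"
    using \<open>c \<noteq> 0\<close> unfolding m[symmetric] by (simp add: m_def c_def)
  moreover have "continuous_on (ball a \<delta>) \<phi>"
    using cont by (simp add: continuous_at_imp_continuous_on)
  ultimately show ?thesis
    using that \<open>\<delta> > 0\<close> \<open>\<phi> a = b\<close> \<phi>(2) by blast
qed

section \<open>Real arcs of a plane curve\<close>

lemma vector2_eq_axis: "(vector [x, y] :: real^2) = x *\<^sub>R axis 1 1 + y *\<^sub>R axis 2 1"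
  by (simp add: vec_eq_iff forall_2 axis_def)

lemma vector2_eta [simp]: "vector [v$1, v$2] = (v :: 'a::zero^2)"
  by (simp add: vec_eq_iff forall_2)

lemma complexify_nth [simp]: "complexify x $ i = complex_of_real (x $ i)"
  by (simp add: complexify_def)

lemma complexify_vector2: "complexify (vector [x, y] :: real^2)
    = vector [complex_of_real x, complex_of_real y]"
  by (simp add: vec_eq_iff forall_2)

lemma continuous_on_vector2 [continuous_intros]:
  fixes f g :: "'b::topological_space \<Rightarrow> 'a::{topological_space,zero}"
  assumes "continuous_on A f" "continuous_on A g"
  shows "continuous_on A (\<lambda>t. vector [f t, g t] :: 'a^2)"
proof -
  have "(\<lambda>t. vector [f t, g t] :: 'a^2) = (\<lambda>t. \<chi> i. if i = 1 then f t else g t)"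
    by (simp add: fun_eq_iff vec_eq_iff forall_2)
  moreover have "continuous_on A (\<lambda>t. if i = 1 then f t else g t)" for i :: 2
    using assms by (cases "i = 1") auto
  ultimately show ?thesis
    by (simp only:) (rule continuous_on_vec_lambda)
qed

lemma has_vector_derivative_vector2:
  fixes f g :: "real \<Rightarrow> real"
  assumes "(f has_real_derivative a) (at t)" "(g has_real_derivative b) (at t)"
  shows "((\<lambda>t. vector [f t, g t] :: real^2) has_vector_derivative vector [a, b]) (at t)"
  unfolding vector2_eq_axis
  by (intro has_vector_derivative_add
      has_vector_derivative_scaleR[where g' = 0, simplified] assms has_vector_derivative_const)

lemma has_real_derivative_nth:
  fixes \<gamma> :: "real \<Rightarrow> real^'n"
  assumes "(\<gamma> has_vector_derivative v) (at t)"
  shows "((\<lambda>t. \<gamma> t $ i) has_real_derivative v $ i) (at t)"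
  using bounded_linear.has_vector_derivative[OF bounded_linear_vec_nth assms]
  by (simp add: has_real_derivative_iff_has_vector_derivative)

text \<open>Dimension 1 rules out the whole plane, so some \<open>g\<close> has non-zero
  differential at \<open>P\<close>, and it rules out the zero space, so there is a non-zero tangent
  vector \<open>t\<close>. The kernel of the differential of \<open>g\<close> is then the line
  spanned by \<open>t\<close>, which lies in the tangent space.\<close>

lemma tangent_space_nonsingular:
  assumes "vec.dim (tangent_space S P) = 1"
  obtains g where "g \<in> vanishing_ideal S" "eval2 (dx g) P \<noteq> 0 \<or> eval2 (dy g) P \<noteq> 0"
    "tangent_space S P = {u. eval2 (dx g) P * u$1 + eval2 (dy g) P * u$2 = 0}"
proof -
  have "\<exists>g\<in>vanishing_ideal S. eval2 (dx g) P \<noteq> 0 \<or> eval2 (dy g) P \<noteq> 0"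
  proof (rule ccontr)
    assume "\<not> ?thesis"
    then have "tangent_space S P = UNIV"
      by (auto simp: tangent_space_def)
    then show False
      using assms vec_dim_card[where 'a = complex and 'n = 2] by (simp del: vec.dim_UNIV)
  qed
  then obtain g where g: "g \<in> vanishing_ideal S" "eval2 (dx g) P \<noteq> 0 \<or> eval2 (dy g) P \<noteq> 0"
    by blast
  have "\<not> tangent_space S P \<subseteq> {0}"
    using assms vec.dim_eq_0 by (metis zero_neq_one)
  then obtain t where t: "t \<in> tangent_space S P" "t \<noteq> 0"
    by blast
  have "u \<in> tangent_space S P" if u: "eval2 (dx g) P * u$1 + eval2 (dy g) P * u$2 = 0" for u
  proof -
    have tg: "eval2 (dx g) P * t$1 + eval2 (dy g) P * t$2 = 0"
      using t(1) g(1) by (auto simp: tangent_space_def)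
    \<comment> \<open>Both \<open>u\<close> and \<open>t\<close> lie in the kernel of the same
      non-zero linear form on a plane, hence are parallel.\<close>
    have par: "u$1 * t$2 = u$2 * t$1"
      using g(2)
    proof
      assume nz: "eval2 (dx g) P \<noteq> 0"
      have "eval2 (dx g) P * (u$1 * t$2 - u$2 * t$1) = 0"
        using u tg by algebra
      then show ?thesis
        using nz by simp
    next
      assume nz: "eval2 (dy g) P \<noteq> 0"
      have "eval2 (dy g) P * (u$1 * t$2 - u$2 * t$1) = 0"
        using u tg by algebra
      then show ?thesis
        using nz by simp
    qed
    show ?thesis
      unfolding tangent_space_def
    proof safe
      fix p
      assume "p \<in> vanishing_ideal S"
      then have tp: "eval2 (dx p) P * t$1 + eval2 (dy p) P * t$2 = 0"
        using t(1) by (auto simp: tangent_space_def)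
      \<comment> \<open>By parallelism, multiplying the value of the differential of
        \<open>p\<close> at \<open>u\<close> by a coordinate of \<open>t\<close> gives the value at
        \<open>t\<close> times the same coordinate of \<open>u\<close>, which is zero.\<close>
      have "t$1 * (eval2 (dx p) P * u$1 + eval2 (dy p) P * u$2) = 0"
        "t$2 * (eval2 (dx p) P * u$1 + eval2 (dy p) P * u$2) = 0"
        using tp par by algebra+
      moreover have "t$1 \<noteq> 0 \<or> t$2 \<noteq> 0"
        using t(2) by (simp add: vec_eq_iff forall_2)
      ultimately show "eval2 (dx p) P * u$1 + eval2 (dy p) P * u$2 = 0"
        by auto
    qed
  qed
  with g show ?thesis
    by (intro that[of g]) (auto simp: tangent_space_def)
qed

text \<open>The implicit function argument is applied with the real defining polynomial as
  \<open>F\<close> and an element of the vanishing ideal with non-zero differential as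
  \<open>G\<close>. The arc is a graph over whichever coordinate axis the differential allows, and
  its real velocity spans the complex tangent line.\<close>

lemma nonsingular_point_branch:
  assumes S: "S = zero_locus (complexify_poly f)"
    and P: "complexify P \<in> nonsingular_points S"
  obtains \<gamma> :: "real \<Rightarrow> real^2" and v a \<delta> where "\<delta> > 0" "\<gamma> a = P" "continuous_on (ball a \<delta>) \<gamma>"
    "\<gamma> ` ball a \<delta> \<subseteq> real_points S" "(\<gamma> has_vector_derivative v) (at a)" "v \<noteq> 0"
    "tangent_space S (complexify P) = {u. complexify v $ 2 * u$1 = complexify v $ 1 * u$2}"
proof -
  define p where "p = complexify_poly f"
  from P have "complexify P \<in> S" "vec.dim (tangent_space S (complexify P)) = 1"
    by (auto simp: nonsingular_points_def)
  from tangent_space_nonsingular[OF this(2)] obtain g where g: "g \<in> vanishing_ideal S"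
      "eval2 (dx g) (complexify P) \<noteq> 0 \<or> eval2 (dy g) (complexify P) \<noteq> 0"
    and T: "tangent_space S (complexify P) =
      {u. eval2 (dx g) (complexify P) * u$1 + eval2 (dy g) (complexify P) * u$2 = 0}"
    by blast
  have inS: "v \<in> S \<longleftrightarrow> eval2 p v = 0" for v
    by (simp add: S zero_locus_def p_def)
  have g0: "eval2 g v = 0" if "eval2 p v = 0" for v
    using that g(1) inS by (auto simp: vanishing_ideal_def)
  have cP: "complexify P = vector [of_real (P$1), of_real (P$2)]"
    by (simp add: vec_eq_iff forall_2)
  have p0: "eval2 p (vector [of_real (P$1), of_real (P$2)]) = 0"
    using \<open>complexify P \<in> S\<close> inS cP by simp
  have cont: "continuous_on UNIV (\<lambda>z :: complex \<times> complex. eval2 h (vector [fst z, snd z]))"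
      "continuous_on UNIV (\<lambda>z :: complex \<times> complex. eval2 h (vector [snd z, fst z]))" for h
    by (intro continuous_intros)+
  have partial1: "((\<lambda>x. eval2 h (vector [x, y]))
      has_field_derivative eval2 (dx h) (vector [x, y])) (at x)"
    and partial2: "((\<lambda>y. eval2 h (vector [x, y]))
        has_field_derivative eval2 (dy h) (vector [x, y])) (at y)"
    for h and x y :: complex
    using has_field_derivative_eval2[OF DERIV_ident DERIV_const, where p = h]
      has_field_derivative_eval2[OF DERIV_const DERIV_ident, where p = h] by simp_all
  have holo: "(\<lambda>y. eval2 h (vector [x, y])) holomorphic_on UNIV"
    "(\<lambda>x. eval2 h (vector [x, y])) holomorphic_on UNIV" for h x y
    unfolding holomorphic_on_def field_differentiable_def
    by (intro ballI exI, rule partial2, intro ballI exI, rule partial1)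
  show ?thesis
  proof (cases "eval2 (dy g) (complexify P) = 0")
    case False
    obtain \<phi> :: "real \<Rightarrow> real" and m \<delta> where \<phi>: "\<delta> > 0" "\<phi> (P$1) = P$2"
      "continuous_on (ball (P$1) \<delta>) \<phi>"
      "\<And>x. x \<in> ball (P$1) \<delta> \<Longrightarrow> eval2 p (vector [of_real x, of_real (\<phi> x)]) = 0"
      "(\<phi> has_real_derivative m) (at (P$1))"
      "eval2 (dx g) (complexify P) + eval2 (dy g) (vector [of_real (P$1), of_real (P$2)]) * of_real m = 0"
    proof (rule implicit_real_branch[where F = "\<lambda>x y. eval2 p (vector [x, y])"
          and G = "\<lambda>x y. eval2 g (vector [x, y])" and Gy = "\<lambda>x y. eval2 (dy g) (vector [x, y])"
          and a = "P$1" and b = "P$2" and gx = "eval2 (dx g) (complexify P)"])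
      show "((\<lambda>x. eval2 g (vector [x, of_real (P$2) + m * (x - of_real (P$1))]))
          has_field_derivative
          eval2 (dx g) (complexify P) + eval2 (dy g) (vector [of_real (P$1), of_real (P$2)]) * m)
          (at (of_real (P$1)))" for m
        by (rule DERIV_cong[OF has_field_derivative_eval2[where X' = 1 and Y' = m]])
          (auto intro!: derivative_eq_intros simp: cP)
    qed (use cont holo partial2 p0 g0 False cP in
        \<open>auto simp: case_prod_unfold p_def eval2_complexify_poly_cnj\<close>)
    show ?thesis
    proof (rule that[of \<delta> "\<lambda>x. vector [x, \<phi> x]" "P$1" "vector [1, m]"])
      show "continuous_on (ball (P$1) \<delta>) (\<lambda>x. vector [x, \<phi> x] :: real^2)"
        by (intro continuous_intros \<phi>)
      show "((\<lambda>x. vector [x, \<phi> x]) has_vector_derivative (vector [1, m] :: real^2)) (at (P$1))"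
        by (intro has_vector_derivative_vector2 DERIV_ident \<phi>)
      have gx: "eval2 (dx g) (complexify P) = - (eval2 (dy g) (complexify P) * of_real m)"
        using \<phi>(6) by (simp add: cP eq_neg_iff_add_eq_0)
      have "eval2 (dx g) (complexify P) * u$1 + eval2 (dy g) (complexify P) * u$2 =
          eval2 (dy g) (complexify P) * (u$2 - of_real m * u$1)" for u :: "complex^2"
        unfolding gx by (simp add: algebra_simps)
      then show "tangent_space S (complexify P) =
          {u. complexify (vector [1, m] :: real^2) $ 2 * u$1
              = complexify (vector [1, m] :: real^2) $ 1 * u$2}"
        using False by (auto simp: T)
    qed (use \<phi> in \<open>auto simp: real_points_def inS complexify_vector2 vec_eq_iff forall_2\<close>)
  next
    case True
    \<comment> \<open>Here the arc is a graph over the second coordinate, so both functions take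
      their arguments in the opposite order.\<close>
    then have False': "eval2 (dx g) (complexify P) \<noteq> 0"
      using g(2) by simp
    obtain \<phi> :: "real \<Rightarrow> real" and m \<delta> where \<phi>: "\<delta> > 0" "\<phi> (P$2) = P$1"
      "continuous_on (ball (P$2) \<delta>) \<phi>"
      "\<And>y. y \<in> ball (P$2) \<delta> \<Longrightarrow> eval2 p (vector [of_real (\<phi> y), of_real y]) = 0"
      "(\<phi> has_real_derivative m) (at (P$2))"
      "eval2 (dy g) (complexify P) + eval2 (dx g) (vector [of_real (P$1), of_real (P$2)]) * of_real m = 0"
    proof (rule implicit_real_branch[where F = "\<lambda>y x. eval2 p (vector [x, y])"
          and G = "\<lambda>y x. eval2 g (vector [x, y])" and Gy = "\<lambda>y x. eval2 (dx g) (vector [x, y])"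
          and a = "P$2" and b = "P$1" and gx = "eval2 (dy g) (complexify P)"])
      show "((\<lambda>y. eval2 g (vector [of_real (P$1) + m * (y - of_real (P$2)), y]))
          has_field_derivative
          eval2 (dy g) (complexify P) + eval2 (dx g) (vector [of_real (P$1), of_real (P$2)]) * m)
          (at (of_real (P$2)))" for m
        by (rule DERIV_cong[OF has_field_derivative_eval2[where X' = m and Y' = 1]])
          (auto intro!: derivative_eq_intros simp: cP)
    qed (use cont holo partial1 p0 g0 False' cP in
        \<open>auto simp: case_prod_unfold p_def eval2_complexify_poly_cnj\<close>)
    show ?thesis
    proof (rule that[of \<delta> "\<lambda>y. vector [\<phi> y, y]" "P$2" "vector [m, 1]"])
      show "continuous_on (ball (P$2) \<delta>) (\<lambda>y. vector [\<phi> y, y] :: real^2)"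
        by (intro continuous_intros \<phi>)
      show "((\<lambda>y. vector [\<phi> y, y]) has_vector_derivative (vector [m, 1] :: real^2)) (at (P$2))"
        by (intro has_vector_derivative_vector2 DERIV_ident \<phi>)
      have gy: "eval2 (dy g) (complexify P) = - (eval2 (dx g) (complexify P) * of_real m)"
        using \<phi>(6) by (simp add: cP eq_neg_iff_add_eq_0)
      have "eval2 (dx g) (complexify P) * u$1 + eval2 (dy g) (complexify P) * u$2 =
          eval2 (dx g) (complexify P) * (u$1 - of_real m * u$2)" for u :: "complex^2"
        unfolding gy by (simp add: algebra_simps)
      then show "tangent_space S (complexify P) =
          {u. complexify (vector [m, 1] :: real^2) $ 2 * u$1
              = complexify (vector [m, 1] :: real^2) $ 1 * u$2}"
        using False' by (auto simp: T)
    qed (use \<phi> in \<open>auto simp: real_points_def inS complexify_vector2 vec_eq_iff forall_2\<close>)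
  qed
qed

text \<open>The germ conditions hold on a whole interval around 0. Differentiability at every point
  of it gives the continuity that later makes the image of the interval connected.\<close>

lemma smooth_real_branch_arc:
  assumes "smooth_real_branch S P \<gamma>"
  obtains \<delta> where "\<delta> > 0" "continuous_on (ball 0 \<delta>) \<gamma>" "\<gamma> ` ball 0 \<delta> \<subseteq> real_points S"
    "(\<gamma> has_vector_derivative vector_derivative \<gamma> (at 0)) (at 0)"
proof -
  from assms have an: "analytic_at_0 \<gamma>" and in_S: "\<forall>\<^sub>F t in nhds 0. \<gamma> t \<in> real_points S"
    by (auto simp: smooth_real_branch_def)
  have "\<forall>\<^sub>F t in nhds 0. \<exists>D. ((\<lambda>t. \<gamma> t $ i) has_real_derivative D) (at t)" for i
  proof -
    obtain g where g: "g analytic_on {0}"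
        "\<forall>\<^sub>F t in nhds 0. g (complex_of_real t) = complex_of_real (\<gamma> t $ i)"
      using an unfolding analytic_at_0_def by blast
    obtain U where "open U" "0 \<in> U" "g holomorphic_on U"
      using g(1) by (meson analytic_at)
    have "\<forall>\<^sub>F z in nhds (complex_of_real 0). z \<in> U"
      using \<open>open U\<close> \<open>0 \<in> U\<close> by (simp add: eventually_nhds_in_open)
    moreover have "filterlim complex_of_real (nhds (complex_of_real 0)) (nhds 0)"
      using tendsto_of_real[OF filterlim_ident] .
    ultimately have "\<forall>\<^sub>F t in nhds 0. complex_of_real t \<in> U"
      by (rule eventually_compose_filterlim)
    \<comment> \<open>The extension agrees with \<open>\<gamma>\<close> near each \<open>s\<close>
      close to 0, so derivatives can be transferred at \<open>s\<close> and not only at 0.\<close>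
    moreover have "\<forall>\<^sub>F s in nhds 0. \<forall>\<^sub>F t in nhds s. g (complex_of_real t)
        = complex_of_real (\<gamma> t $ i)"
      using g(2) by (simp add: eventually_eventually)
    ultimately show ?thesis
    proof eventually_elim
      case (elim s)
      obtain D where "(g has_field_derivative D) (at (complex_of_real s))"
        using elim(1) \<open>open U\<close> \<open>g holomorphic_on U\<close>
        by (meson field_differentiable_def holomorphic_on_imp_differentiable_at)
      then have "((\<lambda>t. g (complex_of_real t)) has_vector_derivative D) (at s)"
        by (rule has_vector_derivative_real_field)
      then have "((\<lambda>t. Re (g (complex_of_real t))) has_real_derivative Re D) (at s)"
        using bounded_linear.has_vector_derivative[OF bounded_linear_Re]
        by (auto simp: has_real_derivative_iff_has_vector_derivative)
      moreover have "\<forall>\<^sub>F t in nhds s. Re (g (complex_of_real t)) = \<gamma> t $ i"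
        using elim(2) by eventually_elim simp
      ultimately have "((\<lambda>t. \<gamma> t $ i) has_real_derivative Re D) (at s)"
        by (subst (asm) DERIV_cong_ev[OF refl _ refl])
      then show ?case
        by blast
    qed
  qed
  from this[of 1] this[of 2] in_S
  have "\<forall>\<^sub>F t in nhds 0. (\<exists>D. (\<gamma> has_vector_derivative D) (at t)) \<and> \<gamma> t \<in> real_points S"
  proof eventually_elim
    case (elim t)
    then show ?case
      using has_vector_derivative_vector2[of "\<lambda>t. \<gamma> t $ 1" _ t "\<lambda>t. \<gamma> t $ 2"] by auto
  qed
  then obtain \<delta> where "\<delta> > 0" and
    \<delta>: "\<And>t. t \<in> ball 0 \<delta> \<Longrightarrow> (\<exists>D. (\<gamma> has_vector_derivative D) (at t)) \<and> \<gamma> t \<in> real_points S"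
    unfolding eventually_nhds_metric by (auto simp: dist_commute)
  show ?thesis
  proof (rule that[OF \<open>\<delta> > 0\<close>])
    show "continuous_on (ball 0 \<delta>) \<gamma>"
      using \<delta> has_vector_derivative_continuous
      by (blast intro: continuous_at_imp_continuous_on)
    show "(\<gamma> has_vector_derivative vector_derivative \<gamma> (at 0)) (at 0)"
      using \<delta>[of 0] \<open>\<delta> > 0\<close> vector_derivative_works differentiableI_vector by fastforce
  qed (use \<delta> in auto)
qed

section \<open>The affine quadric and its polarity\<close>

text \<open>
  Half of the gradient of \<open>x \<mapsto> q(1, x)\<close>: the coordinates belonging to \<open>X\<^sub>1\<close>, \<open>X\<^sub>2\<close> of the matrix of
  \<open>q\<close> applied to \<open>(1, x)\<close>.
\<close>

definition polar_gradient :: "'a::comm_ring_1^3^3 \<Rightarrow> 'a^2 \<Rightarrow> 'a^2" where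
  "polar_gradient B P = vector [(B *v vector [1, P$1, P$2])$2, (B *v vector [1, P$1, P$2])$3]"

lemma polar_gradient_nth:
  "polar_gradient B P $ 1 = B$2$1 + B$2$2 * P$1 + B$2$3 * P$2"
  "polar_gradient B P $ 2 = B$3$1 + B$3$2 * P$1 + B$3$3 * P$2"
  by (simp_all add: polar_gradient_def matrix_vector_mult_def sum_3)

lemma complexify_polar_gradient:
  "polar_gradient (complexify_matrix B) (complexify P) = complexify (polar_gradient B P)"
  by (simp add: vec_eq_iff forall_2 polar_gradient_nth complexify_matrix_def)

lemma transpose_complexify_matrix:
  "transpose B = B \<Longrightarrow> transpose (complexify_matrix B) = complexify_matrix B"
  by (auto simp: complexify_matrix_def transpose_def vec_eq_iff)

lemma det_complexify_matrix: "det (complexify_matrix B) = complex_of_real (det B)"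
  by (simp add: det_3 complexify_matrix_def)

lemma symmetric_matrix_nth: "transpose B = B \<Longrightarrow> B $ i $ j = B $ j $ i"
  by (metis transpose_def vec_lambda_beta)

text \<open>Since \<open>partial\<close> differentiates in one variable with the others frozen, the
  form is first rewritten as a quadratic polynomial in each single variable.\<close>

lemma partial_quadratic_form:
  assumes "transpose B = B"
  shows "partial (quadratic_form B) i A = 2 * (B *v A) $ i"
proof -
  note sym = symmetric_matrix_nth[OF assms, of 2 1] symmetric_matrix_nth[OF assms, of 3 1]
    symmetric_matrix_nth[OF assms, of 3 2]
  have deriv: "deriv (\<lambda>t. a * t\<^sup>2 + 2 * b * t + c) x = 2 * (a * x + b)" for a b c x :: complex
    by (rule DERIV_imp_deriv) (auto intro!: derivative_eq_intros)
  have expand: "quadratic_form B (\<chi> j. if j = 1 then t else A$j) = B$1$1 * t\<^sup>2 +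
      2 * (B$1$2 * A$2 + B$1$3 * A$3) * t +
      (B$2$2 * (A$2)\<^sup>2 + 2 * B$2$3 * A$2 * A$3 + B$3$3 * (A$3)\<^sup>2)"
    "quadratic_form B (\<chi> j. if j = 2 then t else A$j) = B$2$2 * t\<^sup>2 +
      2 * (B$1$2 * A$1 + B$2$3 * A$3) * t +
      (B$1$1 * (A$1)\<^sup>2 + 2 * B$1$3 * A$1 * A$3 + B$3$3 * (A$3)\<^sup>2)"
    "quadratic_form B (\<chi> j. if j = 3 then t else A$j) = B$3$3 * t\<^sup>2 +
      2 * (B$1$3 * A$1 + B$2$3 * A$2) * t +
      (B$1$1 * (A$1)\<^sup>2 + 2 * B$1$2 * A$1 * A$2 + B$2$2 * (A$2)\<^sup>2)" for t
    by (simp_all add: quadratic_form_def sum_3 sym power2_eq_square algebra_simps)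
  consider "i = 1" | "i = 2" | "i = 3"
    using exhaust_3 by blast
  then show ?thesis
    by cases (simp_all only: partial_def expand deriv, simp_all add: matrix_vector_mult_def sum_3 sym)
qed

lemma polar_quadratic_form:
  assumes "transpose B = B"
  shows "polar (quadratic_form B) M
      = {X. \<forall>A\<in>M. (B *v A)$1 * X$1 + (B *v A)$2 * X$2 + (B *v A)$3 * X$3 = 0}"
proof -
  have "(\<Sum>i\<in>UNIV. partial (quadratic_form B) i A * X$i) =
      2 * ((B *v A)$1 * X$1 + (B *v A)$2 * X$2 + (B *v A)$3 * X$3)" for A X
    by (simp add: partial_quadratic_form[OF assms] sum_3 algebra_simps)
  then show ?thesis
    by (simp add: polar_def del: distrib_left_numeral)
qed

text \<open>Symmetry moves the matrix from \<open>A\<close> to \<open>X\<close>; testing with the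
  second and third unit vectors, which span the line at infinity, leaves two equations.\<close>

lemma polar_line_at_infinity:
  assumes "transpose B = B"
  shows "polar (quadratic_form B) line_at_infinity = {X. (B *v X)$2 = 0 \<and> (B *v X)$3 = 0}"
proof -
  note sym = symmetric_matrix_nth[OF assms, of 2 1] symmetric_matrix_nth[OF assms, of 3 1]
    symmetric_matrix_nth[OF assms, of 3 2]
  have bilinear: "(B *v A)$1 * X$1 + (B *v A)$2 * X$2 + (B *v A)$3 * X$3 =
      A$1 * (B *v X)$1 + A$2 * (B *v X)$2 + A$3 * (B *v X)$3" for A X
    by (simp add: matrix_vector_mult_def sum_3 sym algebra_simps)
  show ?thesis
    unfolding polar_quadratic_form[OF assms] bilinear line_at_infinity_def
  proof (intro equalityI subsetI; clarsimp)
    fix X :: "complex^3"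
    assume *: "\<forall>A::complex^3. A$1 = 0 \<longrightarrow> A$2 * (B *v X)$2 + A$3 * (B *v X)$3 = 0"
    show "(B *v X)$2 = 0 \<and> (B *v X)$3 = 0"
      using *[rule_format, of "vector [0, 1, 0]"] *[rule_format, of "vector [0, 0, 1]"] by simp
  qed
qed

text \<open>The polar point of the line at infinity is the preimage under \<open>B\<close> of the
  first coordinate axis. As \<open>B\<close> is injective, this preimage is spanned by any of its
  non-zero vectors, and a vanishing gradient puts \<open>(1, P)\<close> in it.\<close>

lemma proj_point_eq_polar_line_at_infinity:
  assumes "transpose B = B" "det B \<noteq> 0" "polar_gradient B P = 0"
  shows "proj_point P = polar (quadratic_form B) line_at_infinity"
proof -
  define X where "X = (vector [1, P$1, P$2] :: complex^3)"
  have X: "(B *v X)$2 = 0" "(B *v X)$3 = 0"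
    using assms(3) by (auto simp: polar_gradient_def vec_eq_iff forall_2 X_def)
  have inj: "Y = 0" if "B *v Y = 0" for Y
    using that assms(2) by (metis invertible_det_nz matrix_left_invertible_ker invertible_left_inverse)
  have "X \<noteq> 0"
    by (auto simp: X_def vec_eq_iff forall_3)
  then have X1: "(B *v X)$1 \<noteq> 0"
    using inj[of X] X by (auto simp: vec_eq_iff forall_3)
  have "Y = ((B *v Y)$1 / (B *v X)$1) *s X" if "(B *v Y)$2 = 0" "(B *v Y)$3 = 0" for Y
  proof -
    have "B *v (Y - ((B *v Y)$1 / (B *v X)$1) *s X) = 0"
      using X X1 that
      by (simp add: matrix_vector_mult_diff_distrib vector_scalar_commute vec_eq_iff forall_3)
    then show ?thesis
      using inj by fastforce
  qed
  moreover have "(B *v (k *s X))$2 = 0" "(B *v (k *s X))$3 = 0" for k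
    using X by (simp_all add: vector_scalar_commute)
  ultimately show ?thesis
    unfolding proj_point_def X_def[symmetric] polar_line_at_infinity[OF assms(1)] vec.span_singleton
    by auto
qed

text \<open>Testing against \<open>(1, P)\<close> gives one inclusion. For the other, the vectors
  polar to \<open>(0, v)\<close> form a subspace containing both \<open>(1, P)\<close> and the polar
  point of the line at infinity, hence their join.\<close>

lemma polar_direction_eq:
  assumes "transpose B = B"
  shows "polar_direction (quadratic_form B) P =
    {v. polar_gradient B P $ 1 * v$1 + polar_gradient B P $ 2 * v$2 = 0}"
proof (intro equalityI subsetI)
  fix v :: "complex^2"
  assume v: "v \<in> polar_direction (quadratic_form B) P"
  have "vector [1, P$1, P$2] \<in> join (proj_point P) (polar (quadratic_form B) line_at_infinity)"
    unfolding join_def proj_point_def by (meson UnI1 insertI1 vec.span_base)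
  with v show "v \<in> {v. polar_gradient B P $ 1 * v$1 + polar_gradient B P $ 2 * v$2 = 0}"
    by (auto simp: polar_direction_def line_through_origin_def polar_quadratic_form[OF assms]
        polar_gradient_def)
next
  fix v :: "complex^2"
  assume v: "v \<in> {v. polar_gradient B P $ 1 * v$1 + polar_gradient B P $ 2 * v$2 = 0}"
  define T where "T = {A. (B *v A)$2 * v$1 + (B *v A)$3 * v$2 = 0}"
  have sub: "vec.subspace T"
    unfolding vec.subspace_def T_def
  proof (intro conjI allI ballI; clarsimp simp: matrix_vector_right_distrib vector_scalar_commute)
    fix A A' :: "complex^3"
    assume "(B *v A)$2 * v$1 + (B *v A)$3 * v$2 = 0" "(B *v A')$2 * v$1 + (B *v A')$3 * v$2 = 0"
    then show "((B *v A)$2 + (B *v A')$2) * v$1 + ((B *v A)$3 + (B *v A')$3) * v$2 = 0"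
      by algebra
  next
    fix k and A :: "complex^3"
    assume "(B *v A)$2 * v$1 + (B *v A)$3 * v$2 = 0"
    then show "k * (B *v A)$2 * v$1 + k * (B *v A)$3 * v$2 = 0"
      by algebra
  qed
  have "proj_point P \<subseteq> T"
    unfolding proj_point_def
    by (rule vec.span_minimal[OF _ sub]) (use v in \<open>simp add: T_def polar_gradient_def\<close>)
  moreover have "polar (quadratic_form B) line_at_infinity \<subseteq> T"
    by (auto simp: polar_line_at_infinity[OF assms] T_def)
  ultimately have "join (proj_point P) (polar (quadratic_form B) line_at_infinity) \<subseteq> T"
    unfolding join_def by (intro vec.span_minimal[OF _ sub]) blast
  then show "v \<in> polar_direction (quadratic_form B) P"
    by (auto simp: polar_direction_def line_through_origin_def polar_quadratic_form[OF assms] T_def)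
qed

section \<open>Minima of the affine quadric and arcs through them\<close>

abbreviation affine_quadric :: "real^3^3 \<Rightarrow> real^2 \<Rightarrow> real" where
  "affine_quadric B x \<equiv> quadratic_form B (vector [1, x$1, x$2])"

lemma affine_quadric_derivative:
  assumes sym: "transpose B = B" and \<gamma>: "(\<gamma> has_vector_derivative v) (at t)"
  shows "((\<lambda>t. affine_quadric B (\<gamma> t)) has_real_derivative 2 * (polar_gradient B (\<gamma> t) \<bullet> v)) (at t)"
proof -
  note sym' = symmetric_matrix_nth[OF sym, of 2 1] symmetric_matrix_nth[OF sym, of 3 1]
    symmetric_matrix_nth[OF sym, of 3 2]
  have expand: "affine_quadric B x = B$1$1 + 2 * (B$2$1 * x$1 + B$3$1 * x$2) +
      B$2$2 * (x$1)\<^sup>2 + 2 * B$2$3 * (x$1 * x$2) + B$3$3 * (x$2)\<^sup>2" for x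
    by (simp add: quadratic_form_def sum_3 sym' power2_eq_square algebra_simps)
  note D = has_real_derivative_nth[OF \<gamma>]
  have "((\<lambda>t. affine_quadric B (\<gamma> t)) has_real_derivative
      2 * (B$2$1 * v$1 + B$3$1 * v$2) + B$2$2 * (2 * \<gamma> t$1 * v$1) +
      2 * B$2$3 * (v$1 * \<gamma> t$2 + v$2 * \<gamma> t$1) + B$3$3 * (2 * \<gamma> t$2 * v$2)) (at t)"
    unfolding expand by (auto intro!: derivative_eq_intros D)
  then show ?thesis
    by (rule DERIV_cong) (simp add: polar_gradient_nth inner_vec_def sum_2 sym' algebra_simps)
qed

text \<open>The leading form is at least its minimum on the unit circle times the squared norm, by
  homogeneity, and that minimum is positive; Cauchy-Schwarz bounds the linear part.\<close>

lemma affine_quadric_bounded_below: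
  assumes sym: "transpose B = B"
    and posdef: "\<And>x y. (x, y) \<noteq> (0, 0) \<Longrightarrow> quadratic_form B (vector [0, x, y]) > 0"
  obtains c K where "c > 0" "K \<ge> 0" "\<And>x. affine_quadric B x \<ge> c * (norm x)\<^sup>2 - K * norm x + B$1$1"
proof -
  note sym' = symmetric_matrix_nth[OF sym, of 2 1] symmetric_matrix_nth[OF sym, of 3 1]
    symmetric_matrix_nth[OF sym, of 3 2]
  define Q where "Q x = quadratic_form B (vector [0, x$1, x$2])" for x :: "real^2"
  have Q: "Q x = B$2$2 * (x$1)\<^sup>2 + 2 * B$2$3 * x$1 * x$2 + B$3$3 * (x$2)\<^sup>2" for x
    by (simp add: Q_def quadratic_form_def sum_3 sym' power2_eq_square algebra_simps)
  have "continuous_on (sphere 0 1) Q"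
    unfolding Q by (intro continuous_intros)
  moreover have "sphere (0::real^2) 1 \<noteq> {}"
    by simp
  ultimately obtain x0 where x0: "x0 \<in> sphere 0 1" "\<And>x. x \<in> sphere 0 1 \<Longrightarrow> Q x0 \<le> Q x"
    using continuous_attains_inf[OF compact_sphere] by blast
  have "x0 \<noteq> 0"
    using x0(1) by auto
  then have "Q x0 > 0"
    unfolding Q_def by (intro posdef) (auto simp: vec_eq_iff forall_2)
  have Q_ge: "Q x \<ge> Q x0 * (norm x)\<^sup>2" for x
  proof (cases "x = 0")
    case False
    have "Q x0 \<le> Q ((1 / norm x) *\<^sub>R x)"
      using False by (intro x0) simp
    also have "\<dots> = Q x / (norm x)\<^sup>2"
      unfolding Q using False by (simp add: field_simps power2_eq_square)
    finally show ?thesis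
      using False by (simp add: field_simps)
  qed (simp add: Q)
  define \<beta> where "\<beta> = (vector [B$2$1, B$3$1] :: real^2)"
  have "affine_quadric B x \<ge> Q x0 * (norm x)\<^sup>2 - 2 * norm \<beta> * norm x + B$1$1" for x
  proof -
    have "affine_quadric B x = Q x + 2 * (\<beta> \<bullet> x) + B$1$1"
      by (simp add: Q \<beta>_def quadratic_form_def sum_3 inner_vec_def sum_2 sym' power2_eq_square algebra_simps)
    moreover have "\<beta> \<bullet> x \<ge> - (norm \<beta> * norm x)"
      using Cauchy_Schwarz_ineq2[of \<beta> x] by linarith
    ultimately show ?thesis
      using Q_ge[of x] by linarith
  qed
  with \<open>Q x0 > 0\<close> show ?thesis
    by (intro that[of "Q x0" "2 * norm \<beta>"]) auto
qed

lemma affine_quadric_attains_min: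
  assumes sym: "transpose B = B"
    and posdef: "\<And>x y. (x, y) \<noteq> (0, 0) \<Longrightarrow> quadratic_form B (vector [0, x, y]) > 0"
    and C: "closed C" "C \<noteq> {}"
  obtains P where "P \<in> C" "\<And>x. x \<in> C \<Longrightarrow> affine_quadric B P \<le> affine_quadric B x"
proof -
  obtain c K where cK: "c > 0" "K \<ge> 0"
      "\<And>x. affine_quadric B x \<ge> c * (norm x)\<^sup>2 - K * norm x + B$1$1"
    using affine_quadric_bounded_below[OF sym posdef] by blast
  obtain P0 where "P0 \<in> C"
    using C(2) by blast
  define M where "M = \<bar>affine_quadric B P0 - B$1$1\<bar>"
  \<comment> \<open>For a norm \<open>r\<close> with \<open>r \<ge> 1\<close> and
    \<open>c * r \<ge> K + M\<close>, the lower bound \<open>c * r * r - K * r\<close> is at least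
    \<open>M\<close>, which covers the value at \<open>P0\<close>.\<close>
  define R where "R = max 1 ((K + M) / c)"
  have far: "affine_quadric B x \<ge> affine_quadric B P0" if "norm x \<ge> R" for x
  proof -
    have "norm x \<ge> 1" "K + M \<le> c * norm x"
      using that \<open>c > 0\<close> by (auto simp: R_def field_simps)
    then have "(K + M) * norm x \<le> c * norm x * norm x" "M \<le> M * norm x"
      by (auto intro!: mult_right_mono simp: M_def mult_le_cancel_left1)
    then have "M \<le> c * (norm x)\<^sup>2 - K * norm x"
      by (simp add: power2_eq_square algebra_simps)
    then show ?thesis
      using cK(3)[of x] by (simp add: M_def)
  qed
  have cont: "continuous_on A (affine_quadric B)" for A
    unfolding quadratic_form_def sum_3 by (simp, intro continuous_intros)
  \<comment> \<open>Enlarging the radius to reach \<open>P0\<close> makes the compact set non-empty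
    and allows points outside it to be compared with \<open>P\<close> through
    \<open>P0\<close>.\<close>
  have "compact (C \<inter> cball 0 (max R (norm P0)))"
    using C(1) by (intro closed_Int_compact) auto
  moreover have P0: "P0 \<in> C \<inter> cball 0 (max R (norm P0))"
    using \<open>P0 \<in> C\<close> by simp
  ultimately obtain P where P: "P \<in> C \<inter> cball 0 (max R (norm P0))"
    "\<And>x. x \<in> C \<inter> cball 0 (max R (norm P0)) \<Longrightarrow> affine_quadric B P \<le> affine_quadric B x"
    using continuous_attains_inf[OF _ _ cont] by (metis empty_iff)
  have "affine_quadric B P \<le> affine_quadric B x" if "x \<in> C" for x
  proof (cases "norm x \<le> max R (norm P0)")
    case True
    with that show ?thesis
      by (intro P) simp
  next
    case False
    then have "affine_quadric B P0 \<le> affine_quadric B x"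
      by (intro far) simp
    with P(2)[OF P0] show ?thesis
      by simp
  qed
  with P(1) show ?thesis
    by (intro that[of P]) auto
qed

text \<open>The arc is connected and meets \<open>C\<close>, so maximality of the component places
  it inside \<open>C\<close>. The quadric restricted to the arc then has a local minimum at the
  parameter \<open>a\<close>, and its derivative vanishes there.\<close>

lemma orthogonal_to_arc_at_min:
  assumes sym: "transpose B = B" and C: "C \<in> components X" "\<gamma> a \<in> C"
    and min: "\<And>x. x \<in> C \<Longrightarrow> affine_quadric B (\<gamma> a) \<le> affine_quadric B x"
    and arc: "\<delta> > 0" "continuous_on (ball a \<delta>) \<gamma>" "\<gamma> ` ball a \<delta> \<subseteq> X"
      "(\<gamma> has_vector_derivative v) (at a)"
  shows "polar_gradient B (\<gamma> a) \<bullet> v = 0"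
proof -
  have "\<gamma> ` ball a \<delta> \<subseteq> C"
  proof (rule components_maximal[OF C(1) _ arc(3)])
    show "connected (\<gamma> ` ball a \<delta>)"
      by (intro connected_continuous_image arc connected_ball)
    show "C \<inter> \<gamma> ` ball a \<delta> \<noteq> {}"
      using C(2) \<open>\<delta> > 0\<close> by auto
  qed
  then have "affine_quadric B (\<gamma> a) \<le> affine_quadric B (\<gamma> t)" if "\<bar>a - t\<bar> < \<delta>" for t
    using that by (intro min) (auto simp: dist_real_def)
  with DERIV_local_min[OF affine_quadric_derivative[OF sym arc(4)] \<open>\<delta> > 0\<close>] show ?thesis
    by simp
qed

lemma closed_real_points:
  assumes "S = zero_locus p"
  shows "closed (real_points S)"
proof -
  have "continuous_on UNIV (\<lambda>x. complexify x :: complex^2)"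
    unfolding complexify_def by (intro continuous_on_vec_lambda continuous_intros)
  then have "closed ((\<lambda>x. eval2 p (complexify x)) -` {0})"
    by (intro closed_vimage closed_singleton continuous_on_eval2)
  then show ?thesis
    by (simp add: real_points_def assms zero_locus_def vimage_def)
qed

text \<open>The orthogonal complement of a non-zero vector of the plane is a line. This excludes two
  branches with distinct tangents at the minimum.\<close>

lemma span_eq_if_orthogonal:
  fixes u v w :: "real^2"
  assumes "w \<noteq> 0" "u \<noteq> 0" "v \<noteq> 0" "w \<bullet> u = 0" "w \<bullet> v = 0"
  shows "span {u} = span {v}"
proof -
  have "\<exists>k. u = k *\<^sub>R v" if "v \<noteq> 0" "w \<bullet> u = 0" "w \<bullet> v = 0" for u v
  proof -
    have eqs: "w$1 * u$1 + w$2 * u$2 = 0" "w$1 * v$1 + w$2 * v$2 = 0"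
      using that by (simp_all add: inner_vec_def sum_2)
    have "w$1 * (u$1 * v$2 - u$2 * v$1) = 0" "w$2 * (u$1 * v$2 - u$2 * v$1) = 0"
      using eqs by algebra+
    moreover have "w$1 \<noteq> 0 \<or> w$2 \<noteq> 0"
      using \<open>w \<noteq> 0\<close> by (simp add: vec_eq_iff forall_2)
    ultimately have par: "u$1 * v$2 = u$2 * v$1"
      by auto
    consider "v$1 \<noteq> 0" | "v$2 \<noteq> 0"
      using \<open>v \<noteq> 0\<close> by (auto simp: vec_eq_iff forall_2)
    then show ?thesis
    proof cases
      case 1
      with par show ?thesis
        by (intro exI[of _ "u$1 / v$1"]) (simp add: vec_eq_iff forall_2 field_simps)
    next
      case 2
      with par show ?thesis
        by (intro exI[of _ "u$2 / v$2"]) (simp add: vec_eq_iff forall_2 field_simps)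
    qed
  qed
  then have "u \<in> span {v}" "v \<in> span {u}"
    using assms unfolding span_singleton by (metis rangeI)+
  then show ?thesis
    by (intro equalityI span_minimal) (auto simp: subspace_span)
qed

lemma subset_zariski_closure: "S \<subseteq> zariski_closure S"
  by (auto simp: zariski_closure_def vanishing_ideal_def)

theorem proposition3p3:
  fixes S :: "(complex^2) set" and B :: "real^3^3" and q :: "complex^3 \<Rightarrow> complex"
  defines "q \<equiv> quadratic_form (complexify_matrix B)"
  assumes curve: "real_affine_curve S"
    and nonempty: "real_points S \<noteq> {}"
    and singularities: "\<And>P. P \<in> real_points S \<Longrightarrow> complexify P \<notin> nonsingular_points S \<Longrightarrow>
          ordinary_real_multiple_point S P"
    and symmetric: "transpose B = B"
    and nondegenerate: "det B \<noteq> 0"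
    and posdef: "\<And>x y :: real. (x, y) \<noteq> (0, 0) \<Longrightarrow> quadratic_form B (vector [0, x, y]) > 0"
    and polar_point: "\<And>P. P \<in> real_points S \<Longrightarrow>
          proj_point (complexify P) \<noteq> polar q line_at_infinity"
  shows "\<forall>C\<in>components (real_points S). \<exists>P\<in>C.
           complexify P \<in> nonsingular_points S \<and>
           P \<in> real_points (reciprocal_polar_variety q S)"
proof
  fix C
  assume C: "C \<in> components (real_points S)"
  obtain f where f: "S = zero_locus (complexify_poly f)"
    using curve by (auto simp: real_affine_curve_def)
  have "closed C" "C \<noteq> {}"
    using closed_components[OF closed_real_points[OF f] C] in_components_nonempty[OF C] .
  from affine_quadric_attains_min[OF symmetric posdef this] obtain P where
    P: "P \<in> C" "\<And>x. x \<in> C \<Longrightarrow> affine_quadric B P \<le> affine_quadric B x"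
    by blast
  have PS: "P \<in> real_points S"
    using P(1) in_components_subset[OF C] by blast
  define w where "w = polar_gradient B P"
  have w: "polar_gradient (complexify_matrix B) (complexify P) = complexify w"
    by (simp add: w_def complexify_polar_gradient)
  have symC: "transpose (complexify_matrix B) = complexify_matrix B"
    using symmetric by (rule transpose_complexify_matrix)
  have "w \<noteq> 0"
  proof
    assume "w = 0"
    then have "polar_gradient (complexify_matrix B) (complexify P) = 0"
      unfolding w by (simp add: vec_eq_iff)
    with symC have "proj_point (complexify P) = polar q line_at_infinity"
      unfolding q_def using nondegenerate
      by (intro proj_point_eq_polar_line_at_infinity) (simp_all add: det_complexify_matrix)
    with polar_point[OF PS] show False
      by contradiction
  qed
  have orthogonal: "w \<bullet> v = 0"
    if "\<delta> > 0" "continuous_on (ball a \<delta>) \<gamma>" "\<gamma> ` ball a \<delta> \<subseteq> real_points S"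
      "(\<gamma> has_vector_derivative v) (at a)" "\<gamma> a = P" for \<gamma> a \<delta> v
    using orthogonal_to_arc_at_min[OF symmetric C _ _ that(1-4)] P unfolding that(5) w_def by blast
  have nonsing: "complexify P \<in> nonsingular_points S"
  proof (rule ccontr)
    assume "\<not> ?thesis"
    from singularities[OF PS this] obtain \<Gamma> where \<Gamma>: "card \<Gamma> \<ge> 2" "\<forall>\<gamma>\<in>\<Gamma>. smooth_real_branch S P \<gamma>"
      "\<forall>\<gamma>\<in>\<Gamma>. \<forall>\<delta>\<in>\<Gamma>. \<gamma> \<noteq> \<delta> \<longrightarrow>
           span {vector_derivative \<gamma> (at 0)} \<noteq> span {vector_derivative \<delta> (at 0)}"
      unfolding ordinary_real_multiple_point_def by (elim conjE exE)
    \<comment> \<open>Two distinct branches through the minimum would both have velocity orthogonal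
      to \<open>w\<close>, hence equal tangent lines.\<close>
    obtain \<gamma> \<delta> where \<gamma>\<delta>: "\<gamma> \<in> \<Gamma>" "\<delta> \<in> \<Gamma>" "\<gamma> \<noteq> \<delta>"
      using \<Gamma>(1) by (meson card_2_iff' obtain_subset_with_card_n subsetD)
    have branch: "vector_derivative \<epsilon> (at 0) \<noteq> 0" "w \<bullet> vector_derivative \<epsilon> (at 0) = 0" if
        "\<epsilon> \<in> \<Gamma>" for \<epsilon>
    proof -
      have \<epsilon>: "smooth_real_branch S P \<epsilon>"
        using \<Gamma>(2) that by blast
      then show "vector_derivative \<epsilon> (at 0) \<noteq> 0"
        by (simp add: smooth_real_branch_def)
      obtain d where "d > 0" "continuous_on (ball 0 d) \<epsilon>" "\<epsilon> ` ball 0 d \<subseteq> real_points S"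
        "(\<epsilon> has_vector_derivative vector_derivative \<epsilon> (at 0)) (at 0)"
        using smooth_real_branch_arc[OF \<epsilon>] by blast
      moreover have "\<epsilon> 0 = P"
        using \<epsilon> by (simp add: smooth_real_branch_def)
      ultimately show "w \<bullet> vector_derivative \<epsilon> (at 0) = 0"
        by (rule orthogonal)
    qed
    show False
      using \<Gamma>(3) \<gamma>\<delta> span_eq_if_orthogonal[OF \<open>w \<noteq> 0\<close>] branch by blast
  qed
  obtain \<gamma> v a \<delta> where arc: "\<delta> > 0" "\<gamma> a = P" "continuous_on (ball a \<delta>) \<gamma>"
    "\<gamma> ` ball a \<delta> \<subseteq> real_points S" "(\<gamma> has_vector_derivative v) (at a)" "v \<noteq> 0"
    and T: "tangent_space S (complexify P) = {u. complexify v $ 2 * u$1 = complexify v $ 1 * u$2}"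
    by (rule nonsingular_point_branch[OF f nonsing]) (rule that)
  have "tangent_space S (complexify P) = polar_direction q (complexify P)"
  proof -
    have wv: "w$1 * v$1 + w$2 * v$2 = 0"
      using orthogonal[OF arc(1,3,4,5,2)] by (simp add: inner_vec_def sum_2)
    \<comment> \<open>In the real plane \<open>w\<close> is a non-zero multiple of \<open>v\<close>
      turned by a right angle. The same real factor \<open>k\<close> shows that the complex linear
      equations of the tangent line and of the polar direction are proportional.\<close>
    obtain k where k: "k \<noteq> 0" "w$1 = k * v$2" "w$2 = - (k * v$1)"
    proof (cases "v$2 = 0")
      case True
      then have "v$1 \<noteq> 0" "w$1 = 0"
        using \<open>v \<noteq> 0\<close> wv by (auto simp: vec_eq_iff forall_2)
      moreover have "w$2 \<noteq> 0"
        using \<open>w \<noteq> 0\<close> \<open>w$1 = 0\<close> by (simp add: vec_eq_iff forall_2)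
      ultimately show ?thesis
        using True by (intro that[of "- w$2 / v$1"]) auto
    next
      case False
      have "w$1 \<noteq> 0"
        using False wv \<open>w \<noteq> 0\<close> by (auto simp: vec_eq_iff forall_2)
      with False wv show ?thesis
        by (intro that[of "w$1 / v$2"]) (auto simp: field_simps add_eq_0_iff)
    qed
    have "complexify w $ 1 * u$1 + complexify w $ 2 * u$2 =
        complex_of_real k * (complexify v $ 2 * u$1 - complexify v $ 1 * u$2)" for u :: "complex^2"
      using k by (simp add: algebra_simps)
    then show ?thesis
      using k(1) by (auto simp: q_def polar_direction_eq[OF symC] w T)
  qed
  with nonsing polar_point[OF PS] have "complexify P \<in> reciprocal_polar_variety q S"
    unfolding reciprocal_polar_variety_def by (intro subsetD[OF subset_zariski_closure]) blast
  with nonsing P(1) show "\<exists>P\<in>C. complexify P \<in> nonsingular_points S \<and>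
      P \<in> real_points (reciprocal_polar_variety q S)"
    unfolding real_points_def by blast
qed

end
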